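(* Let $\Gamma_0=(N_0,\mathcal W_0)$ be a simple monotone game with $N_0=\{1,\dots,n\}$ and let $\Gamma_i=(N_i,\mathcal W_i)$ be simple games for all $i\in N_0$. Then Shapley's compound game is given by the total composition of the operad of cooperative games: $$\Gamma_0[\Gamma_1,\dots,\Gamma_n]=\gamma_{\mathbb G}(\Gamma_0;\Gamma_1,\dots,\Gamma_n).$$
   Context: A game is a pair $\Gamma=(N,v)$, $N$ a nonempty finite totally ordered set of players, $v:\mathcal P(N)\to\mathbb R$ with $v(\emptyset)=0$. It is simple if $v(S)\in\{0,1\}$ for all $S$; simple games are taken to satisfy $v(N)=1$. A simple game is determined by its set of winning coalitions $\mathcal W=\{S\subseteq N: v(S)=1\}$. It is monotone if $v(S)\le v(T)$ whenever $S\subseteq T$. The player sets $N_1,\dots,N_n$ are pairwise disjoint. Shapley's compound game $\Gamma_0[\Gamma_1,\dots,\Gamma_n]$ is the simple game on $N=\bigsqcup_{i\in N_0}N_i$ with winning coalitions $\mathcal W=\{S\subseteq N: K(S)\in\mathcal W_0\}$, where $K(S)=\{i\in N_0: S\cap N_i\in\mathcal W_i\}$. Partial composition: for games $(A,\alpha)$, $(B,\beta)$ with disjoint player sets and $i\in A$, $(A,\alpha)\circ_i(B,\beta)$ has player set $A\diamond_iB=(A\setminus\{i\})\cup B$ ($B$ inserted in order in the place of $i$) and coalition function $$(\alpha\circ_i\beta)(S)=\beta(B)\alpha(S\cap A)+\partial_i\alpha(S\cap A)\,\beta(S\cap B),\qquad \partial_i\alpha(T)=\alpha(T\cup\{i\})-\alpha(T\setminus\{i\}).$$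 These form an operad $\mathbb G$; its total composition $\gamma_{\mathbb G}(\Gamma_0;\Gamma_1,\dots,\Gamma_n)$ is $(\cdots((\Gamma_0\circ_n\Gamma_n)\circ_{n-1}\Gamma_{n-1})\cdots)\circ_1\Gamma_1$, where $\circ_i$ is taken at the original player $i$ of $N_0$ (the order of insertion does not matter). *)

theory Defs
  imports Complex_Main "HOL-Library.FuncSet" "HOL-Library.Disjoint_Sets"
begin

text \<open>
  A nonempty finite totally ordered player set is represented by the nonempty distinct list of
  its elements in increasing order. The coalition function only matters on subsets of the player
  set; it is required to be \<^const>\<open>undefined\<close> elsewhere, so that equality of records is equality of
  games: same players, in the same order, with the same coalition function.
\<close>

record 'p game =
  players :: "'p list"
  worth :: "'p set \<Rightarrow> real"

definition is_game :: "'p game \<Rightarrow> bool" where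
  "is_game G \<longleftrightarrow> players G \<noteq> [] \<and> distinct (players G) \<and>
     worth G \<in> extensional (Pow (set (players G))) \<and> worth G {} = 0"

definition simple_game :: "'p game \<Rightarrow> bool" where
  "simple_game G \<longleftrightarrow> is_game G \<and> (\<forall>S \<subseteq> set (players G). worth G S \<in> {0, 1}) \<and>
     worth G (set (players G)) = 1"

definition monotone_game :: "'p game \<Rightarrow> bool" where
  "monotone_game G \<longleftrightarrow>
     (\<forall>S T. S \<subseteq> T \<and> T \<subseteq> set (players G) \<longrightarrow> worth G S \<le> worth G T)"

definition winning :: "'p game \<Rightarrow> 'p set set" where
  "winning G = {S. S \<subseteq> set (players G) \<and> worth G S = 1}"

definition game_of_winning :: "'p list \<Rightarrow> 'p set set \<Rightarrow> 'p game" where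
  "game_of_winning N W =
     \<lparr>players = N, worth = (\<lambda>S\<in>Pow (set N). if S \<in> W then 1 else 0)\<rparr>"


definition winning_components :: "'i game \<Rightarrow> ('i \<Rightarrow> 'p game) \<Rightarrow> 'p set \<Rightarrow> 'i set" where
  "winning_components G0 G S =
     {i \<in> set (players G0). S \<inter> set (players (G i)) \<in> winning (G i)}"

text \<open>
  The disjoint union of the player sets of the components is ordered as the ordinal sum along
  the order of the players of \<open>G0\<close>.
\<close>

definition compound_game :: "'i game \<Rightarrow> ('i \<Rightarrow> 'p game) \<Rightarrow> 'p game" where
  "compound_game G0 G =
     (let N = concat (map (\<lambda>i. players (G i)) (players G0))
      in game_of_winning N {S. S \<subseteq> set N \<and> winning_components G0 G S \<in> winning G0})"


definition insert_players :: "'p list \<Rightarrow> 'p \<Rightarrow> 'p list \<Rightarrow> 'p list" where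
  "insert_players A i B = concat (map (\<lambda>a. if a = i then B else [a]) A)"

definition marginal :: "('p set \<Rightarrow> real) \<Rightarrow> 'p \<Rightarrow> 'p set \<Rightarrow> real" where
  "marginal \<alpha> i T = \<alpha> (T \<union> {i}) - \<alpha> (T - {i})"

text \<open>
  Meaningful for \<open>i\<close> a player of \<open>G\<close> and \<open>G\<close>, \<open>H\<close> with disjoint player sets.
\<close>

definition partial_comp :: "'p game \<Rightarrow> 'p \<Rightarrow> 'p game \<Rightarrow> 'p game" where
  "partial_comp G i H =
     (let A = set (players G); B = set (players H); N = insert_players (players G) i (players H)
      in \<lparr>players = N,
          worth = (\<lambda>S\<in>Pow (set N).
            worth H B * worth G (S \<inter> A) + marginal (worth G) i (S \<inter> A) * worth H (S \<inter> B))\<rparr>)"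


text \<open>Transport of a game along a map that is injective on its players.\<close>

definition relabel :: "('p \<Rightarrow> 'q) \<Rightarrow> 'p game \<Rightarrow> 'q game" where
  "relabel f G =
     \<lparr>players = map f (players G),
      worth = (\<lambda>S\<in>Pow (f ` set (players G)). worth G (f -` S \<inter> set (players G)))\<rparr>"

text \<open>
  The intermediate games have both players of \<open>G0\<close> and players of the components. They live on a
  sum type, which makes the player set of \<open>G0\<close> disjoint from those of the components (the
  latter could themselves contain the numbers \<open>1, \<dots>, n\<close>). The last player of \<open>G0\<close> is replaced
  first; once all are replaced only players of the form \<open>Inr p\<close> remain, and the tag is dropped.
\<close>

definition total_comp :: "'i game \<Rightarrow> ('i \<Rightarrow> 'p game) \<Rightarrow> 'p game" where
  "total_comp G0 G =
     relabel projr
       (foldr (\<lambda>i H. partial_comp H (Inl i) (relabel Inr (G i))) (players G0) (relabel Inl G0))"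

end

theory Submission
  imports Defs
begin

text \<open>
  Inserting a simple game \<open>H\<close> at the player \<open>i\<close> replaces \<open>i\<close> by a committee: in the formula
  \<open>\<beta>(B) \<alpha>(S \<inter> A) + \<partial>\<^sub>i\<alpha>(S \<inter> A) \<beta>(S \<inter> B)\<close> one has \<open>\<beta>(B) = 1\<close>, a coalition \<open>S\<close> of the composite never
  contains \<open>i\<close>, and \<open>\<beta>(S \<inter> B)\<close> is a switch with values \<open>0\<close> and \<open>1\<close>. When it is \<open>0\<close> the formula is
  \<open>\<alpha>(S \<inter> A)\<close>; when it is \<open>1\<close> the sum telescopes to \<open>\<alpha>((S \<inter> A) \<union> {i})\<close>. So \<open>S\<close> is worth what
  the outer game pays when \<open>i\<close> joins exactly if its committee \<open>B\<close> wins (\<open>worth_partial_comp_simple\<close>).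

  Consequently, after the players in a final segment of \<open>G0\<close> have been replaced, a coalition is
  worth \<open>worth G0\<close> of the set of the unreplaced players in it together with the replaced players
  whose component it wins. This invariant, the game \<open>committee_game\<close>, is carried along the total
  composition (\<open>partial_comp_committee_game\<close>, \<open>foldr_partial_comp_eq_committee_game\<close>). Once no
  player of \<open>G0\<close> is left, the set in question is the set \<open>K(S)\<close> of Shapley's definition, and
  since \<open>worth G0\<close> takes only the values \<open>0\<close> and \<open>1\<close>, it is the indicator of the winning
  coalitions of the compound game.
\<close>

lemma simple_game_relabel:
  assumes "simple_game G" and "inj_on f (set (players G))"
  shows "simple_game (relabel f G)"
proof -
  have "f -` f ` set (players G) \<inter> set (players G) = set (players G)"
    by auto
  then show ?thesis
    using assms by (auto simp: simple_game_def is_game_def relabel_def distinct_map)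
qed

lemma worth_partial_comp_simple:
  assumes "simple_game H" and "i \<in> set (players G)" and "i \<notin> S"
    and "S \<subseteq> set (insert_players (players G) i (players H))"
  shows "worth (partial_comp G i H) S =
    worth G (S \<inter> set (players G) \<union> (if worth H (S \<inter> set (players H)) = 1 then {i} else {}))"
proof -
  have "worth H (S \<inter> set (players H)) \<in> {0, 1}" "worth H (set (players H)) = 1"
    using assms(1) by (auto simp: simple_game_def)
  moreover have "S \<inter> set (players G) - {i} = S \<inter> set (players G)"
    using assms(3) by auto
  ultimately show ?thesis
    using assms(4) by (auto simp: partial_comp_def Let_def marginal_def)
qed

text \<open>
  The state of the total composition when the players \<open>ys\<close> of \<open>G0\<close> are still in place and the
  players \<open>xs\<close> have been replaced by their components.
\<close>

definition committee_game ::
    "'i game \<Rightarrow> ('i \<Rightarrow> 'p game) \<Rightarrow> 'i list \<Rightarrow> 'i list \<Rightarrow> ('i + 'p) game" where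
  "committee_game G0 G ys xs =
     (let N = map Inl ys @ concat (map (\<lambda>i. map Inr (players (G i))) xs)
      in \<lparr>players = N,
          worth = (\<lambda>S\<in>Pow (set N).
            worth G0 ({i \<in> set ys. Inl i \<in> S} \<union>
              {i \<in> set xs. worth (G i) (Inr -` S \<inter> set (players (G i))) = 1}))\<rparr>)"

lemma players_committee_game:
  "players (committee_game G0 G ys xs) =
    map Inl ys @ concat (map (\<lambda>i. map Inr (players (G i))) xs)"
  by (simp add: committee_game_def Let_def)

lemma worth_committee_game:
  assumes "S \<subseteq> set (players (committee_game G0 G ys xs))"
  shows "worth (committee_game G0 G ys xs) S =
    worth G0 ({i \<in> set ys. Inl i \<in> S} \<union>
      {i \<in> set xs. worth (G i) (Inr -` S \<inter> set (players (G i))) = 1})"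
  using assms unfolding players_committee_game by (simp add: committee_game_def Let_def)

lemma worth_committee_game_undefined:
  assumes "\<not> S \<subseteq> set (players (committee_game G0 G ys xs))"
  shows "worth (committee_game G0 G ys xs) S = undefined"
  using assms unfolding players_committee_game by (simp add: committee_game_def Let_def)

lemma insert_players_notin: "i \<notin> set A \<Longrightarrow> insert_players A i B = A"
  by (induction A) (auto simp: insert_players_def)

lemma insert_players_split:
  assumes "i \<notin> set A" and "i \<notin> set C"
  shows "insert_players (A @ i # C) i B = A @ B @ C"
  using insert_players_notin[OF assms(1), of B] insert_players_notin[OF assms(2), of B]
  by (simp add: insert_players_def)

lemma partial_comp_committee_game:
  assumes "simple_game (G i)" and "i \<notin> set ys"
  shows "partial_comp (committee_game G0 G (ys @ [i]) xs) (Inl i) (relabel Inr (G i)) =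
    committee_game G0 G ys (i # xs)" (is "partial_comp ?C _ ?H = ?D")
proof -
  have players_eq: "insert_players (players ?C) (Inl i) (players ?H) = players ?D"
    using assms(2) insert_players_split[of "Inl i" "map Inl ys"
        "concat (map (\<lambda>i. map Inr (players (G i))) xs)" "players ?H"]
    by (auto simp: players_committee_game relabel_def)
  have "worth (partial_comp ?C (Inl i) ?H) S = worth ?D S" for S
  proof (cases "S \<subseteq> set (players ?D)")
    case True
    let ?P = "\<lambda>j. set (players (G j))"
    let ?J = "if worth (G i) (Inr -` S \<inter> ?P i) = 1 then {Inl i} else {}"
    let ?T = "S \<inter> set (players ?C) \<union> ?J"
    have notin: "Inl i \<notin> S"
      using True assms(2) by (auto simp: players_committee_game)
    have worth_H: "worth ?H (S \<inter> set (players ?H)) = worth (G i) (Inr -` S \<inter> ?P i)"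
    proof -
      have "Inr -` (S \<inter> Inr ` ?P i) \<inter> ?P i = Inr -` S \<inter> ?P i"
        by auto
      then show ?thesis
        by (simp add: relabel_def)
    qed
    have "worth (partial_comp ?C (Inl i) ?H) S = worth ?C ?T"
      using worth_partial_comp_simple[of ?H "Inl i" ?C S] assms(1) notin True players_eq worth_H
      by (simp add: simple_game_relabel players_committee_game)
    also have "\<dots> = worth G0 ({j \<in> set (ys @ [i]). Inl j \<in> ?T} \<union>
        {j \<in> set xs. worth (G j) (Inr -` ?T \<inter> ?P j) = 1})"
      by (rule worth_committee_game) (auto simp: players_committee_game)
    \<comment> \<open>A component of \<open>xs\<close> may be judged by \<open>S\<close> itself, because \<open>?T\<close> and \<open>S\<close> have the same members in it.\<close>
    also have "{j \<in> set xs. worth (G j) (Inr -` ?T \<inter> ?P j) = 1} =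
        {j \<in> set xs. worth (G j) (Inr -` S \<inter> ?P j) = 1}"
    proof -
      have "Inr -` ?T \<inter> ?P j = Inr -` S \<inter> ?P j" if "j \<in> set xs" for j
        using that by (auto simp: players_committee_game)
      then show ?thesis
        by auto
    qed
    also have "{j \<in> set (ys @ [i]). Inl j \<in> ?T} \<union>
          {j \<in> set xs. worth (G j) (Inr -` S \<inter> ?P j) = 1} =
        {j \<in> set ys. Inl j \<in> S} \<union>
          {j \<in> set (i # xs). worth (G j) (Inr -` S \<inter> ?P j) = 1}"
      using notin assms(2) by (auto simp: players_committee_game)
    also have "worth G0 \<dots> = worth ?D S"
      using worth_committee_game[OF True] by simp
    finally show ?thesis .
  next
    case False
    then show ?thesis
      by (simp add: worth_committee_game_undefined partial_comp_def players_eq Let_def)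
  qed
  then show ?thesis
    by (intro game.equality) (auto simp: partial_comp_def players_eq Let_def)
qed

lemma foldr_partial_comp_eq_committee_game:
  assumes "players G0 = ys @ xs" and "distinct (players G0)"
    and "\<And>i. i \<in> set xs \<Longrightarrow> simple_game (G i)"
  shows "foldr (\<lambda>i H. partial_comp H (Inl i) (relabel Inr (G i))) xs (relabel Inl G0) =
    committee_game G0 G ys xs"
  using assms
proof (induction xs arbitrary: ys)
  case Nil
  have "Inl -` S \<inter> set ys = {i \<in> set ys. Inl i \<in> S}" for S :: "('a + 'b) set"
    by auto
  then show ?case
    using Nil by (simp add: relabel_def committee_game_def)
next
  case (Cons i xs)
  then show ?case
    using Cons.IH[of "ys @ [i]"] by (simp add: partial_comp_committee_game)
qed

theorem compound_game_eq_total_comp: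
  assumes "simple_game G0" and "\<And>i. i \<in> set (players G0) \<Longrightarrow> simple_game (G i)"
  shows "compound_game G0 G = total_comp G0 G"
proof -
  let ?I = "set (players G0)"
  let ?P = "\<lambda>i. set (players (G i))"
  let ?C = "committee_game G0 G [] (players G0)"
  let ?N = "concat (map (\<lambda>i. players (G i)) (players G0))"
  have total: "total_comp G0 G = relabel projr ?C"
    using foldr_partial_comp_eq_committee_game[of G0 "[]" "players G0" G] assms
    by (simp add: total_comp_def simple_game_def is_game_def)
  have players_C: "players ?C = map Inr ?N"
    by (simp add: players_committee_game map_concat o_def)
  have "worth (compound_game G0 G) S = worth (relabel projr ?C) S" for S
  proof (cases "S \<subseteq> set ?N")
    case True
    have "projr -` S \<inter> set (players ?C) = Inr ` S"
      using True by (force simp: players_C)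
    then have "worth (relabel projr ?C) S = worth ?C (Inr ` S)"
      using True by (simp add: relabel_def players_C image_image)
    also have "\<dots> = worth G0 {i \<in> ?I. worth (G i) (S \<inter> ?P i) = 1}"
      using True by (subst worth_committee_game) (auto simp: players_C inj_vimage_image_eq)
    also have "\<dots> = worth G0 (winning_components G0 G S)"
      by (simp add: winning_components_def winning_def)
    also have "\<dots> = (if winning_components G0 G S \<in> winning G0 then 1 else 0)"
    proof -
      have "winning_components G0 G S \<subseteq> ?I"
        by (auto simp: winning_components_def)
      then show ?thesis
        using assms(1) by (auto simp: simple_game_def winning_def)
    qed
    also have "\<dots> = worth (compound_game G0 G) S"
      using True by (simp add: compound_game_def game_of_winning_def Let_def)
    finally show ?thesis
      by simp
  next
    case False
    then show ?thesis
      by (simp add: compound_game_def game_of_winning_def relabel_def players_C image_image Let_def)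
  qed
  then show ?thesis
    unfolding total
    by (intro game.equality)
      (auto simp: compound_game_def game_of_winning_def relabel_def players_C o_def Let_def)
qed

theorem proposition5:
  fixes n :: nat and G0 :: "nat game" and G :: "nat \<Rightarrow> 'p game"
  assumes "players G0 = [1..<Suc n]"
    and "simple_game G0" and "monotone_game G0"
    and "\<And>i. i \<in> {1..n} \<Longrightarrow> simple_game (G i)"
    and "disjoint_family_on (\<lambda>i. set (players (G i))) {1..n}"
  shows "compound_game G0 G = total_comp G0 G"
proof (rule compound_game_eq_total_comp)
  show "simple_game (G i)" if "i \<in> set (players G0)" for i
    using that assms(1,4) by auto
qed (rule assms(2))

end
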